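(* For every positive integer $n$, \[ q^{\binom{n}{2}}C_n\!\left(\tfrac{1}{q}\right)=\sum_{\substack{\lambda=(\lambda_1,\dots,\lambda_k)\\ \lambda_1+k\leq n}}\ \prod_{i \geq 1} \binom{\lambda_i-\lambda_{i+2}+1}{\lambda_{i+1}-\lambda_{i+2}}\, q^{\binom{\lambda_1}{2}+|\lambda|}, \] where the sum runs over all partitions $\lambda$ (including the empty partition) with $k$ nonzero parts and largest part $\lambda_1$ satisfying $\lambda_1+k\le n$.
   Context: A partition $\lambda=(\lambda_1\ge\lambda_2\ge\cdots)$ is identified with its sequence of parts, with $\lambda_i=0$ for $i>k$, where $k$ is the number of nonzero parts; $|\lambda|=\sum_i\lambda_i$, and $\lambda_1=0$ for the empty partition. A Dyck path of length $n$ is a lattice path from $(0,0)$ to $(n,n)$ consisting of unit north steps $(0,1)$ and east steps $(1,0)$ that never goes strictly below the line $y=x$. Its coarea is the number of unit lattice squares lying entirely in the region between the path and the diagonal $y=x$. The Carlitz $q$-Catalan number is $C_n(q)=\sum_{p}q^{\mathrm{coarea}(p)}$, summed over all Dyck paths $p$ of length $n$. *)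

theory Defs
  imports Complex_Main "HOL-Library.Groups_Big_Fun"
begin

section \<open>Partitions\<close>

text \<open>A partition is the weakly decreasing list of its nonzero parts, so that its number of
  nonzero parts is its \<open>length\<close> and its size is its \<open>sum_list\<close>.\<close>

definition is_partition :: "nat list \<Rightarrow> bool" where
  "is_partition lam \<longleftrightarrow> sorted_wrt (\<ge>) lam \<and> 0 \<notin> set lam"

text \<open>Parts are numbered from 1, and \<open>part lam i = 0\<close> beyond the last one.
  The value at \<open>i = 0\<close> is irrelevant.\<close>

definition part :: "nat list \<Rightarrow> nat \<Rightarrow> nat" where
  "part lam i = (if 1 \<le> i \<and> i \<le> length lam then lam ! (i - 1) else 0)"

text \<open>The infinite product over \<open>i \<ge> 1\<close>, where \<open>i = Suc j\<close>. It is a product of finitely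
  many factors different from 1, see \<open>binom_weight_eq_finite_prod\<close> below. The subtractions do
  not truncate on partitions.\<close>

definition binom_weight :: "nat list \<Rightarrow> nat" where
  "binom_weight lam =
     (\<Prod>j. ((part lam (Suc j) - part lam (Suc j + 2) + 1) choose
           (part lam (Suc j + 1) - part lam (Suc j + 2))))"

lemma binom_weight_eq_finite_prod:
  "binom_weight lam =
     (\<Prod>i = 1..length lam. ((part lam i - part lam (i + 2) + 1) choose
                            (part lam (i + 1) - part lam (i + 2))))"
proof -
  let ?f = "\<lambda>i. ((part lam i - part lam (i + 2) + 1) choose
                 (part lam (i + 1) - part lam (i + 2)))"
  have "binom_weight lam = (\<Prod>j. ?f (Suc j))"
    unfolding binom_weight_def by simp
  also have "\<dots> = (\<Prod>j\<in>{..<length lam}. ?f (Suc j))"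
  proof (rule Prod_any.expand_superset)
    show "{j. ?f (Suc j) \<noteq> 1} \<subseteq> {..<length lam}"
      by (rule subsetI, rule ccontr) (auto simp: part_def)
  qed simp
  also have "\<dots> = (\<Prod>i = 1..length lam. ?f i)"
    by (rule prod.reindex_bij_witness[of _ "\<lambda>i. i - 1" Suc]) auto
  finally show ?thesis .
qed

lemma finite_partitions_hook:
  "finite {lam. is_partition lam \<and> part lam 1 + length lam \<le> n}"
proof (rule finite_subset)
  show "{lam. is_partition lam \<and> part lam 1 + length lam \<le> n}
          \<subseteq> {xs. set xs \<subseteq> {..n} \<and> length xs \<le> n}"
  proof
    fix lam assume "lam \<in> {lam. is_partition lam \<and> part lam 1 + length lam \<le> n}"
    then show "lam \<in> {xs. set xs \<subseteq> {..n} \<and> length xs \<le> n}"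
      by (cases lam) (fastforce simp: is_partition_def part_def)+
  qed
qed (simp add: finite_lists_length_le)

section \<open>Dyck paths and the Carlitz $q$-Catalan numbers\<close>

datatype step = North | East

definition point :: "step list \<Rightarrow> nat \<Rightarrow> nat \<times> nat" where
  "point p m = (count_list (take m p) East, count_list (take m p) North)"

definition dyck_paths :: "nat \<Rightarrow> step list set" where
  "dyck_paths n = {p. point p (length p) = (n, n) \<and>
                      (\<forall>m \<le> length p. fst (point p m) \<le> snd (point p m))}"

text \<open>The pair \<open>(i, j)\<close> stands for the unit square $[i,i+1] \times [j,j+1]$. It lies on or above
  the diagonal iff its lower right corner does, i.e. iff \<open>i + 1 \<le> j\<close>; it lies under the path iff
  the east step of the path over $[i,i+1]$ has height at least \<open>j + 1\<close>.\<close>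

definition squares_between :: "step list \<Rightarrow> (nat \<times> nat) set" where
  "squares_between p =
     {(i, j). i + 1 \<le> j \<and>
        (\<exists>m < length p. p ! m = East \<and> fst (point p m) = i \<and> j + 1 \<le> snd (point p m))}"

definition coarea :: "step list \<Rightarrow> nat" where
  "coarea p = card (squares_between p)"

text \<open>The polynomial identity in an indeterminate \<open>q\<close> is the instance in which \<open>'a\<close> is a
  polynomial ring or its fraction field and \<open>q\<close> is the variable.\<close>

definition carlitz_catalan :: "nat \<Rightarrow> 'a::comm_semiring_1 \<Rightarrow> 'a" where
  "carlitz_catalan n q = (\<Sum>p\<in>dyck_paths n. q ^ coarea p)"

lemma finite_dyck_paths: "finite (dyck_paths n)"
proof (rule finite_subset)
  have len: "length p = count_list p East + count_list p North" for p
    by (induction p) (auto intro: step.exhaust)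
  have "UNIV = {North, East}"
    using step.exhaust by blast
  then have "finite (UNIV :: step set)"
    by (metis finite.emptyI finite_insert)
  then show "finite {p :: step list. set p \<subseteq> UNIV \<and> length p \<le> 2 * n}"
    by (rule finite_lists_length_le)
  show "dyck_paths n \<subseteq> {p. set p \<subseteq> UNIV \<and> length p \<le> 2 * n}"
    by (auto simp: dyck_paths_def point_def len)
qed

lemma finite_squares_between: "finite (squares_between p)"
proof (rule finite_subset)
  show "squares_between p \<subseteq> {..length p} \<times> {..length p}"
  proof
    fix s assume "s \<in> squares_between p"
    then obtain i j m where s: "s = (i, j)" "i + 1 \<le> j" "j + 1 \<le> snd (point p m)"
      by (auto simp: squares_between_def)
    have "snd (point p m) \<le> length (take m p)"
      by (simp only: point_def snd_conv count_le_length)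
    with s show "s \<in> {..length p} \<times> {..length p}"
      by simp
  qed
qed simp

end

theory Submission
  imports Defs
begin

text \<open>Let $f_j$ be the number of east steps of a Dyck path that start at height $j$ above the
  diagonal. Each of them contributes $j - 1$ to the coarea, and the paths of height $h$ with given
  $f_1, \dots, f_h \ge 1$ are counted by
  $\prod_{j<h} \binom{f_j + f_{j+1} - 1}{f_{j+1}}$. With $h = n - \lambda_1$ and
  $f_j = \lambda_{h+1-j} - \lambda_{h+2-j} + 1$ these sequences of sum $n$ correspond
  bijectively to the partitions with $\lambda_1 + k \le n$, the product becomes the weight of
  $\lambda$, and $\sum_j (j-1) f_j = \binom{n}{2} - \binom{\lambda_1}{2} - |\lambda|$.\<close>

section \<open>Dyck prefixes and their profiles\<close>

text \<open>In \<open>dyck_prefix p a f\<close> the path ends at height \<open>a\<close> above the diagonal, and \<open>f j\<close> is the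
  number of its east steps that start at height \<open>j\<close>.\<close>

inductive dyck_prefix :: "step list \<Rightarrow> nat \<Rightarrow> (nat \<Rightarrow> nat) \<Rightarrow> bool" where
  Nil: "dyck_prefix [] 0 (\<lambda>_. 0)"
| North: "dyck_prefix p a f \<Longrightarrow> dyck_prefix (p @ [North]) (Suc a) f"
| East: "dyck_prefix p (Suc a) f \<Longrightarrow> dyck_prefix (p @ [East]) a (f(Suc a := Suc (f (Suc a))))"

lemma sum_mult_fun_upd_Suc:
  fixes f g :: "nat \<Rightarrow> nat"
  assumes "finite A" "k \<in> A"
  shows "(\<Sum>j\<in>A. g j * (f(k := Suc (f k))) j) = (\<Sum>j\<in>A. g j * f j) + g k"
proof -
  have "(\<Sum>j\<in>A. g j * (f(k := Suc (f k))) j) = (\<Sum>j\<in>A. g j * f j + (if j = k then g k else 0))"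
    by (rule sum.cong) auto
  then show ?thesis
    using assms by (simp add: sum.distrib)
qed

text \<open>The last step decides which rule was applied, and each rule can be undone; a path has
  one profile.\<close>

lemma dyck_prefix_functional:
  "dyck_prefix p a f \<Longrightarrow> dyck_prefix p b g \<Longrightarrow> a = b \<and> f = g"
proof (induction arbitrary: b g rule: dyck_prefix.induct)
  case Nil
  then show ?case by (cases rule: dyck_prefix.cases) auto
next
  case (North p a f)
  from North.prems North.IH show ?case by (cases rule: dyck_prefix.cases) auto
next
  case (East p a f)
  from East.prems East.IH show ?case by (cases rule: dyck_prefix.cases) auto
qed

lemma dyck_prefix_counts: "dyck_prefix p a f \<Longrightarrow> count_list p North = count_list p East + a"
  by (induction rule: dyck_prefix.induct) auto

lemma dyck_prefix_support:
  "dyck_prefix p a f \<Longrightarrow> f 0 = 0 \<and> (\<forall>j > count_list p North. f j = 0)"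
proof (induction rule: dyck_prefix.induct)
  case (East p a f)
  then show ?case using dyck_prefix_counts[OF East.hyps] by auto
qed auto

text \<open>A path that reaches height \<open>Suc j\<close> and ends below \<open>j\<close> must
  come down by an east step starting at \<open>j\<close>.\<close>

lemma dyck_prefix_gap:
  "dyck_prefix p a f \<Longrightarrow> a < j \<Longrightarrow> f j = 0 \<Longrightarrow> f (Suc j) = 0"
  by (induction arbitrary: j rule: dyck_prefix.induct) (auto split: if_splits)

lemma dyck_prefix_sum:
  "dyck_prefix p a f \<Longrightarrow> count_list p North \<le> n \<Longrightarrow> (\<Sum>j\<le>n. f j) = count_list p East"
proof (induction rule: dyck_prefix.induct)
  case (East p a f)
  then show ?case
    using dyck_prefix_counts[OF East.hyps] sum_mult_fun_upd_Suc[of "{..n}" "Suc a" "\<lambda>_. 1" f]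
    by (auto simp del: fun_upd_apply)
qed auto

section \<open>Coarea in terms of the profile\<close>

lemma point_snoc:
  "m \<le> length p \<Longrightarrow> point (p @ [s]) m = point p m"
  by (simp add: point_def)

lemma squares_between_snoc:
  "squares_between (p @ [s]) = squares_between p \<union>
     (if s = East then {(i, j). i = count_list p East \<and> i + 1 \<le> j \<and> j + 1 \<le> count_list p North}
      else {})"
proof -
  let ?P = "\<lambda>p i j m. p ! m = East \<and> fst (point p m) = i \<and> j + 1 \<le> snd (point p m)"
  have old: "?P (p @ [s]) i j m \<longleftrightarrow> ?P p i j m" if "m < length p" for i j m
    using that by (simp add: nth_append point_snoc)
  have new: "?P (p @ [s]) i j (length p) \<longleftrightarrow>
      s = East \<and> i = count_list p East \<and> j + 1 \<le> count_list p North" for i j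
    by (auto simp: point_def)
  have "(\<exists>m < length (p @ [s]). ?P (p @ [s]) i j m) \<longleftrightarrow>
      (s = East \<and> i = count_list p East \<and> j + 1 \<le> count_list p North) \<or>
      (\<exists>m < length p. ?P p i j m)" for i j
    by (simp only: length_append_singleton Ex_less_Suc old new cong: conj_cong)
  then show ?thesis
    unfolding squares_between_def by auto
qed

text \<open>Old squares lie to the left of the next east step, so the column added by that step is
  disjoint from them.\<close>

lemma squares_between_column:
  assumes "(i, j) \<in> squares_between p"
  shows "i < count_list p East"
proof -
  obtain m where m: "m < length p" "p ! m = East" "count_list (take m p) East = i"
    using assms by (auto simp: squares_between_def point_def)
  have "p = take m p @ East # drop (Suc m) p"
    using id_take_nth_drop[OF m(1)] m(2) by simp
  then have "count_list p East = count_list (take m p @ East # drop (Suc m) p) East"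
    by simp
  with m show ?thesis by simp
qed

lemma coarea_snoc:
  "coarea (p @ [s]) = coarea p +
     (if s = East then count_list p North - count_list p East - 1 else 0)"
proof (cases "s = East")
  case True
  let ?E = "count_list p East" and ?N = "count_list p North"
  let ?new = "{(i, j). i = ?E \<and> i + 1 \<le> j \<and> j + 1 \<le> ?N}"
  \<comment> \<open>The column runs from the diagonal at \<open>?E + 1\<close> up to the path; it is
    empty exactly when the truncated difference is 0.\<close>
  have new: "?new = Pair ?E ` {?E + 1..<?N}" by auto
  have "card ?new = ?N - ?E - 1"
    unfolding new by (subst card_image) (auto simp: inj_on_def)
  moreover have "squares_between p \<inter> ?new = {}"
    using squares_between_column by fastforce
  moreover have "finite ?new" unfolding new by simp
  ultimately show ?thesis
    using True finite_squares_between[of p]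
    by (simp add: coarea_def squares_between_snoc card_Un_disjoint)
qed (simp add: coarea_def squares_between_snoc)

text \<open>Before an east step from height \<open>Suc a\<close> the counts of north and east steps
  differ by \<open>Suc a\<close>, so its column has \<open>a\<close> squares.\<close>

lemma coarea_dyck_prefix:
  "dyck_prefix p a f \<Longrightarrow> count_list p North \<le> n \<Longrightarrow> coarea p = (\<Sum>j\<le>n. (j - 1) * f j)"
proof (induction rule: dyck_prefix.induct)
  case Nil
  then show ?case by (simp add: coarea_def squares_between_def)
next
  case (North p a f)
  then show ?case by (simp add: coarea_snoc)
next
  case (East p a f)
  then show ?case
    using dyck_prefix_counts[OF East.hyps] sum_mult_fun_upd_Suc[of "{..n}" "Suc a" "\<lambda>j. j - 1" f]
    by (auto simp: coarea_snoc simp del: fun_upd_apply)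
qed

section \<open>Dyck paths as prefixes ending on the diagonal\<close>

lemma dyck_prefix_point:
  "dyck_prefix p a f \<Longrightarrow> m \<le> length p \<Longrightarrow> fst (point p m) \<le> snd (point p m)"
proof (induction arbitrary: m rule: dyck_prefix.induct)
  case (North p a f)
  then show ?case using dyck_prefix_counts[OF North.hyps]
    by (cases "m \<le> length p") (auto simp: point_snoc le_Suc_eq, auto simp: point_def)
next
  case (East p a f)
  then show ?case using dyck_prefix_counts[OF East.hyps]
    by (cases "m \<le> length p") (auto simp: point_snoc le_Suc_eq, auto simp: point_def)
qed (simp add: point_def)

lemma ex_dyck_prefix:
  assumes "\<And>m. m \<le> length p \<Longrightarrow> fst (point p m) \<le> snd (point p m)"
  shows "\<exists>a f. dyck_prefix p a f"
  using assms
proof (induction p rule: rev_induct)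
  case Nil
  then show ?case using dyck_prefix.Nil by blast
next
  case (snoc s p)
  have "fst (point p m) \<le> snd (point p m)" if "m \<le> length p" for m
    using snoc.prems[of m] that by (simp add: point_snoc)
  then obtain a f where af: "dyck_prefix p a f"
    using snoc.IH by blast
  show ?case
  proof (cases s)
    case North
    then show ?thesis using dyck_prefix.North[OF af] by blast
  next
    case East
    \<comment> \<open>An east step from the diagonal would put the endpoint of the extended path
      below it.\<close>
    have "a \<noteq> 0"
      using snoc.prems[of "Suc (length p)"] dyck_prefix_counts[OF af] East
      by (auto simp: point_def)
    then obtain b where "a = Suc b"
      using not0_implies_Suc by blast
    then show ?thesis using East af dyck_prefix.East by blast
  qed
qed

lemma dyck_paths_iff:
  "p \<in> dyck_paths n \<longleftrightarrow> count_list p North = n \<and> (\<exists>f. dyck_prefix p 0 f)"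
proof
  assume p: "p \<in> dyck_paths n"
  then have cnt: "count_list p North = n" "count_list p East = n"
    by (auto simp: dyck_paths_def point_def)
  obtain a f where af: "dyck_prefix p a f"
    using ex_dyck_prefix p by (fastforce simp: dyck_paths_def)
  with cnt dyck_prefix_counts[OF af] show "count_list p North = n \<and> (\<exists>f. dyck_prefix p 0 f)"
    by auto
next
  assume "count_list p North = n \<and> (\<exists>f. dyck_prefix p 0 f)"
  then obtain f where f: "count_list p North = n" "dyck_prefix p 0 f" by blast
  with dyck_prefix_counts[OF f(2)] dyck_prefix_point[OF f(2)] show "p \<in> dyck_paths n"
    by (auto simp: dyck_paths_def point_def)
qed

section \<open>Counting prefixes with a given profile\<close>

text \<open>A prefix is determined by the words recording, for each height, the order of the steps
  leaving that height. Above the final height such a word ends with an east step, which explains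
  the \<open>- 1\<close>; below it, the word ends with a north step that \<open>f\<close> does not record. Removing
  the last step of the path turns the product of these factors into Pascal's rule.\<close>

definition level_factor :: "nat \<Rightarrow> (nat \<Rightarrow> nat) \<Rightarrow> nat \<Rightarrow> nat" where
  "level_factor a f j =
     (if j \<le> a then (f j + f (Suc j)) choose f j else (f j + f (Suc j) - 1) choose f (Suc j))"

lemma dyck_prefixes_step:
  "{p. dyck_prefix p a f} =
     (if a = 0 \<and> f = (\<lambda>_. 0) then {[]} else {}) \<union>
     (if a = 0 then {} else (\<lambda>p. p @ [North]) ` {p. dyck_prefix p (a - 1) f}) \<union>
     (if f (Suc a) = 0 then {}
      else (\<lambda>p. p @ [East]) ` {p. dyck_prefix p (Suc a) (f(Suc a := f (Suc a) - 1))})"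
  (is "?L = ?R")
proof
  show "?L \<subseteq> ?R"
  proof
    fix p assume "p \<in> ?L"
    then have "dyck_prefix p a f" by simp
    then show "p \<in> ?R" by (cases rule: dyck_prefix.cases) auto
  qed
  have "dyck_prefix (p @ [East]) a f"
    if "f (Suc a) \<noteq> 0" "dyck_prefix p (Suc a) (f(Suc a := f (Suc a) - 1))" for p
    using dyck_prefix.East[OF that(2)] that(1) by simp
  moreover have "dyck_prefix (p @ [North]) a f" if "a \<noteq> 0" "dyck_prefix p (a - 1) f" for p
    using dyck_prefix.North[OF that(2)] that(1) by simp
  ultimately show "?R \<subseteq> ?L"
    using dyck_prefix.Nil by (auto split: if_splits)
qed

text \<open>Undoing the last step changes the value of the factor at height \<open>a\<close> only,
  and there the values satisfy Pascal's rule. The hypothesis \<open>ne\<close> sets aside the case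
  in which no last step is possible.\<close>

lemma level_factor_pascal:
  assumes "f 0 = 0" and supp: "\<And>j. j > N \<Longrightarrow> f j = 0" and ne: "a \<noteq> 0 \<or> f (Suc a) \<noteq> 0"
  shows "(\<Prod>j\<le>N. level_factor a f j) =
    (if a = 0 then 0 else \<Prod>j\<le>N. level_factor (a - 1) f j) +
    (if f (Suc a) = 0 then 0
     else \<Prod>j\<le>N. level_factor (Suc a) (f(Suc a := f (Suc a) - 1)) j)"
proof (cases "a \<le> N")
  case False
  then have "f (Suc a) = 0" using supp by simp
  moreover have "(\<Prod>j\<le>N. level_factor a f j) = (\<Prod>j\<le>N. level_factor (a - 1) f j)"
    using False by (intro prod.cong) (auto simp: level_factor_def)
  ultimately show ?thesis using ne by simp
next
  case True
  let ?g = "f(Suc a := f (Suc a) - 1)"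
  let ?Q = "\<Prod>j\<in>{..N} - {a}. level_factor a f j"
  have split: "(\<Prod>j\<le>N. h j) = h a * (\<Prod>j\<in>{..N} - {a}. h j)" for h :: "nat \<Rightarrow> nat"
    using True by (simp add: prod.remove)
  have north: "(\<Prod>j\<in>{..N} - {a}. level_factor (a - 1) f j) = ?Q"
    by (intro prod.cong) (auto simp: level_factor_def)
  have east: "(\<Prod>j\<in>{..N} - {a}. level_factor (Suc a) ?g j) = ?Q" if "f (Suc a) \<noteq> 0"
  proof (intro prod.cong refl)
    fix j assume "j \<in> {..N} - {a}"
    then consider "j < a" | "j = Suc a" | "j > Suc a" by fastforce
    then show "level_factor (Suc a) ?g j = level_factor a f j"
    proof cases
      \<comment> \<open>The factor passes from the kind above to the kind at or below the final
        height; with one east step fewer the two binomials agree by symmetry.\<close>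
      assume "j = Suc a"
      then show ?thesis using that
        binomial_symmetric[of "f (Suc a) - 1" "f (Suc a) - 1 + f (Suc (Suc a))"]
        by (simp add: level_factor_def)
    qed (auto simp: level_factor_def)
  qed
  have pascal: "level_factor a f a =
    (if a = 0 then 0 else level_factor (a - 1) f a) +
    (if f (Suc a) = 0 then 0 else level_factor (Suc a) ?g a)"
  proof (cases "a = 0")
    case True
    then show ?thesis using assms by (simp add: level_factor_def)
  next
    case False
    show ?thesis
    proof (cases "f (Suc a)")
      case 0
      then show ?thesis using False by (simp add: level_factor_def)
    next
      case (Suc m)
      show ?thesis
      proof (cases "f a")
        \<comment> \<open>Here the north term is \<open>m choose Suc m = 0\<close>, and the other
          two values are 1.\<close>
        case 0
        then show ?thesis using Suc \<open>a \<noteq> 0\<close> by (simp add: level_factor_def)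
      next
        case (Suc k)
        have "(k + Suc m) choose Suc m = (k + Suc m) choose k"
          using binomial_symmetric[of k "k + Suc m"] by simp
        then show ?thesis using Suc \<open>f (Suc a) = Suc m\<close> \<open>a \<noteq> 0\<close>
          by (simp add: level_factor_def)
      qed
    qed
  qed
  show ?thesis
    by (cases "f (Suc a) = 0")
      (simp_all only: split pascal north east distrib_right if_distrib[of "\<lambda>x. x * ?Q"]
        if_True if_False mult_zero_left simp_thms)
qed

text \<open>A nonzero profile would start at some height \<open>i > 1\<close>, and the factor just
  below is \<open>(f i - 1) choose f i = 0\<close>. For the zero profile truncation turns
  \<open>0 - 1\<close> into 0, so every factor is 1.\<close>

lemma level_factor_vanish:
  assumes "f 0 = 0" "f (Suc 0) = 0" and supp: "\<And>j. j > N \<Longrightarrow> f j = 0"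
  shows "(\<Prod>j\<le>N. level_factor 0 f j) = (if f = (\<lambda>_. 0) then 1 else 0)"
proof (cases "f = (\<lambda>_. 0)")
  case False
  then obtain k where "f k \<noteq> 0" by auto
  define i where "i = (LEAST k. f k \<noteq> 0)"
  have i: "f i \<noteq> 0"
    unfolding i_def using \<open>f k \<noteq> 0\<close> by (rule LeastI)
  have below: "f j = 0" if "j < i" for j
    using that not_less_Least[of j "\<lambda>k. f k \<noteq> 0"] unfolding i_def by blast
  obtain j where j: "i = Suc j" "j \<noteq> 0"
    using i assms(1,2) by (metis not0_implies_Suc)
  have "level_factor 0 f j = 0"
    using i below[of j] j by (simp add: level_factor_def)
  moreover have "j \<le> N" using i supp[of i] j by (cases "j \<le> N") auto
  ultimately show ?thesis using False by auto
qed (simp add: level_factor_def cong: if_cong)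

lemma card_dyck_prefixes:
  assumes "f 0 = 0" and "\<And>j. j > N \<Longrightarrow> f j = 0"
  shows "finite {p. dyck_prefix p a f} \<and>
    card {p. dyck_prefix p a f} = (\<Prod>j\<le>N. level_factor a f j)"
  using assms
\<comment> \<open>The measure is the length of a path with \<open>\<Sum>j\<le>N. f j\<close> east
  steps and \<open>a\<close> more north steps than that.\<close>
proof (induction "2 * (\<Sum>j\<le>N. f j) + a" arbitrary: a f rule: less_induct)
  case less
  let ?g = "f(Suc a := f (Suc a) - 1)"
  let ?A = "if a = 0 then {} else (\<lambda>p. p @ [North]) ` {p. dyck_prefix p (a - 1) f}"
  let ?B = "if f (Suc a) = 0 then {} else (\<lambda>p. p @ [East]) ` {p. dyck_prefix p (Suc a) ?g}"
  have A: "finite ?A \<and> card ?A = (if a = 0 then 0 else \<Prod>j\<le>N. level_factor (a - 1) f j)"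
    using less.hyps[of f "a - 1"] less.prems by (simp add: card_image inj_on_def)
  have B: "finite ?B \<and> card ?B =
      (if f (Suc a) = 0 then 0 else \<Prod>j\<le>N. level_factor (Suc a) ?g j)"
  proof (cases "f (Suc a) = 0")
    case False
    then have "Suc a \<le> N" using less.prems(2)[of "Suc a"] by (cases "Suc a \<le> N") auto
    moreover have "?g(Suc a := Suc (?g (Suc a))) = f" using False by auto
    ultimately have "(\<Sum>j\<le>N. f j) = (\<Sum>j\<le>N. ?g j) + 1"
      using sum_mult_fun_upd_Suc[of "{..N}" "Suc a" "\<lambda>_. 1" ?g]
      by (simp only: mult_1 finite_atMost atMost_iff True_implies_equals)
    with less.hyps[of ?g "Suc a"] less.prems False show ?thesis
      by (simp add: card_image inj_on_def)
  qed simp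
  have AB: "finite (?A \<union> ?B) \<and> card (?A \<union> ?B) = card ?A + card ?B"
  proof -
    have "?A \<inter> ?B = {}" by auto
    then show ?thesis using A B card_Un_disjoint[of ?A ?B] by blast
  qed
  show ?case
  proof (cases "a = 0 \<and> f (Suc a) = 0")
    case True
    then show ?thesis
      using level_factor_vanish[of f N] less.prems by (subst (1 2) dyck_prefixes_step) auto
  next
    case False
    then have "{p. dyck_prefix p a f} = ?A \<union> ?B"
      by (subst dyck_prefixes_step) auto
    moreover have "card ?A + card ?B = (\<Prod>j\<le>N. level_factor a f j)"
      using A B False level_factor_pascal[of f N a] less.prems by presburger
    ultimately show ?thesis
      using AB by presburger
  qed
qed

section \<open>Partitions as profiles\<close>

lemma part_pos_iff:
  "is_partition lam \<Longrightarrow> i \<ge> 1 \<Longrightarrow> 0 < part lam i \<longleftrightarrow> i \<le> length lam"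
  by (auto simp: part_def is_partition_def) (metis Suc_le_eq Suc_pred gr0I not_less_eq_eq nth_mem)

lemma part_beyond: "length lam < i \<Longrightarrow> part lam i = 0"
  by (simp add: part_def)

lemma part_mono:
  assumes "is_partition lam" "1 \<le> i" "i \<le> j"
  shows "part lam j \<le> part lam i"
proof (cases "i < j")
  case True
  then show ?thesis
    using assms sorted_wrt_nth_less[of "(\<ge>)" lam "i - 1" "j - 1"]
    by (auto simp: part_def is_partition_def)
qed (use assms in auto)

lemma partition_eqI:
  assumes "is_partition lam" "is_partition mu" "\<And>i. i \<ge> 1 \<Longrightarrow> part lam i = part mu i"
  shows "lam = mu"
proof (rule nth_equalityI)
  have le: "i \<le> length lam \<longleftrightarrow> i \<le> length mu" if "i \<ge> 1" for i
    using assms part_pos_iff that by metis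
  then show len: "length lam = length mu"
    by (metis le_antisym le_refl less_one linorder_le_less_linear)
  fix i assume "i < length lam"
  then show "lam ! i = mu ! i"
    using assms(3)[of "Suc i"] len by (simp add: part_def)
qed

lemma ex_partition_of_parts:
  fixes l :: "nat \<Rightarrow> nat"
  assumes mono: "\<And>i j. 1 \<le> i \<Longrightarrow> i \<le> j \<Longrightarrow> l j \<le> l i" and "l (Suc h) = 0"
  obtains lam where "is_partition lam" "length lam \<le> h" "\<And>i. i \<ge> 1 \<Longrightarrow> part lam i = l i"
proof -
  define k where "k = (LEAST k. l (Suc k) = 0)"
  have k: "l (Suc k) = 0" "k \<le> h"
    unfolding k_def using assms(2) by (rule LeastI, rule Least_le)
  have pos: "l (Suc i) \<noteq> 0" if "i < k" for i
    using that not_less_Least unfolding k_def by blast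
  let ?lam = "map (\<lambda>i. l (Suc i)) [0..<k]"
  have "is_partition ?lam"
    unfolding is_partition_def
  proof
    show "sorted_wrt (\<ge>) ?lam"
      by (simp add: sorted_wrt_iff_nth_less mono)
    show "0 \<notin> set ?lam"
      using pos by (metis (no_types, lifting) atLeastLessThan_iff imageE set_map set_upt)
  qed
  moreover have "part ?lam i = l i" if "i \<ge> 1" for i
    using that mono[of "Suc k" i] k(1) by (auto simp: part_def)
  ultimately show ?thesis using that[of ?lam] k(2) by simp
qed

lemma sum_list_eq_sum_part:
  assumes "length lam \<le> h"
  shows "sum_list lam = (\<Sum>i=1..h. part lam i)"
proof -
  have "sum_list lam = (\<Sum>i<length lam. part lam (Suc i))"
    by (simp add: sum_list_sum_nth part_def atLeast0LessThan)
  also have "\<dots> = (\<Sum>i<h. part lam (Suc i))"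
    using assms by (intro sum.mono_neutral_left) (auto simp: part_def)
  also have "\<dots> = (\<Sum>i=1..h. part lam i)"
    by (rule sum.reindex_bij_witness[of _ "\<lambda>i. i - 1" Suc]) auto
  finally show ?thesis .
qed

section \<open>The correspondence between partitions and profiles\<close>

definition profile :: "nat \<Rightarrow> nat list \<Rightarrow> nat \<Rightarrow> nat" where
  "profile n lam j =
     (let h = n - part lam 1 in
      if 1 \<le> j \<and> j \<le> h then part lam (h + 1 - j) - part lam (h + 2 - j) + 1 else 0)"

abbreviation (input) hook_partitions :: "nat \<Rightarrow> nat list set" where
  "hook_partitions n \<equiv> {lam. is_partition lam \<and> part lam 1 + length lam \<le> n}"

text \<open>With \<open>h = n - part lam 1\<close> the differences in \<open>profile\<close>
  telescope, starting from \<open>part lam (h + 1) = 0\<close>, since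
  \<open>length lam \<le> h\<close>.\<close>

lemma part_from_profile:
  assumes "lam \<in> hook_partitions n" "t \<le> n - part lam 1"
  shows "(\<Sum>j=1..t. profile n lam j - 1) = part lam (n - part lam 1 + 1 - t)"
  using assms(2)
proof (induction t)
  case 0
  have "length lam \<le> n - part lam 1" using assms(1) by auto
  then show ?case by (simp add: part_beyond)
next
  case (Suc t)
  define h where "h = n - part lam 1"
  have "part lam (h + 1 - t) \<le> part lam (h - t)"
    using Suc.prems assms(1) by (intro part_mono) (auto simp: h_def)
  moreover have "profile n lam (Suc t) - 1 = part lam (h - t) - part lam (h + 1 - t)"
    using Suc.prems unfolding profile_def Let_def h_def[symmetric] by simp
  moreover have "(\<Sum>j=1..t. profile n lam j - 1) = part lam (h + 1 - t)"
    using Suc by (simp add: h_def)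
  ultimately have "(\<Sum>j=1..Suc t. profile n lam j - 1) = part lam (h - t)"
    by simp
  then show ?case by (simp add: h_def)
qed

lemma part_eq_sum_profile:
  assumes "lam \<in> hook_partitions n" "1 \<le> i" "i \<le> h" "h = n - part lam 1"
  shows "part lam i = (\<Sum>j=1..h + 1 - i. profile n lam j - 1)"
  using part_from_profile[OF assms(1), of "h + 1 - i"] assms(2,3) unfolding assms(4)[symmetric]
  by simp

text \<open>The summand \<open>+ 1\<close> makes \<open>profile n lam\<close> positive exactly at
  heights 1 to \<open>n - part lam 1\<close>, so this bound can be read off; partial sums then give
  the parts.\<close>

lemma inj_on_profile: "inj_on (profile n) (hook_partitions n)"
proof (rule inj_onI)
  fix lam mu assume lam: "lam \<in> hook_partitions n" and mu: "mu \<in> hook_partitions n"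
    and eq: "profile n lam = profile n mu"
  let ?h = "n - part lam 1"
  have pos: "0 < profile n nu j \<longleftrightarrow> 1 \<le> j \<and> j \<le> n - part nu 1" for nu j
    by (simp add: profile_def Let_def)
  have "1 \<le> j \<and> j \<le> ?h \<longleftrightarrow> 1 \<le> j \<and> j \<le> n - part mu 1" for j
    using eq pos by metis
  then have h: "n - part mu 1 = ?h"
    by (metis le_antisym le_refl less_one linorder_le_less_linear)
  show "lam = mu"
  proof (rule partition_eqI)
    fix i :: nat assume i: "i \<ge> 1"
    show "part lam i = part mu i"
    proof (cases "i \<le> ?h")
      case True
      then show ?thesis
        using part_eq_sum_profile[OF lam i True refl] part_eq_sum_profile[OF mu i True h[symmetric]]
          eq by simp
    next
      case False
      then have "length lam < i" "length mu < i" using lam mu h by auto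
      then show ?thesis by (simp add: part_beyond)
    qed
  qed (use lam mu in auto)
qed

section \<open>The exponent of q\<close>

text \<open>Summation by parts turns the differences of \<open>L\<close> into \<open>t * L t\<close>
  minus the sum of \<open>L\<close>; the summands \<open>+ 1\<close> contribute the sum of all
  \<open>j - 1\<close>, which is \<open>t choose 2\<close>.\<close>

lemma sum_level_add_sum:
  fixes L :: "nat \<Rightarrow> nat"
  assumes "L 0 = 0" "\<And>j. j < t \<Longrightarrow> L j \<le> L (Suc j)"
  shows "(\<Sum>j=1..t. (j - 1) * (L j - L (j - 1) + 1)) + (\<Sum>j=1..t. L j) = t * L t + (t choose 2)"
  using assms
proof (induction t)
  case (Suc t)
  obtain d where "L (Suc t) = L t + d"
    using Suc.prems(2)[of t] le_iff_add by auto
  then show ?case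
    using Suc by (simp add: numeral_2_eq_2 algebra_simps)
qed simp

lemma choose_two_add: "(a + b) choose 2 = (a choose 2) + (b choose 2) + a * b" for a b :: nat
  by (induction a) (auto simp: numeral_2_eq_2)

text \<open>Reading the parts backwards, \<open>sum_level_add_sum\<close> gives
  \<open>h * part lam 1 + (h choose 2)\<close>; adding \<open>part lam 1 choose 2\<close> yields
  \<open>n choose 2\<close>, as \<open>h + part lam 1 = n\<close>.\<close>

lemma profile_exponent:
  assumes "lam \<in> hook_partitions n"
  shows "(\<Sum>j\<le>n. (j - 1) * profile n lam j) + ((part lam 1 choose 2) + sum_list lam) = n choose 2"
proof -
  define h where "h = n - part lam 1"
  let ?L = "\<lambda>j. part lam (h + 1 - j)"
  have len: "length lam \<le> h" "part lam 1 \<le> n" "is_partition lam"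
    using assms by (auto simp: h_def)
  have "h \<le> n" by (simp add: h_def)
  note prof = profile_def[of n lam, folded h_def, unfolded Let_def]
  have "(\<Sum>j\<le>n. (j - 1) * profile n lam j) = (\<Sum>j=1..h. (j - 1) * (?L j - ?L (j - 1) + 1))"
    using \<open>h \<le> n\<close> by (intro sum.mono_neutral_cong_right) (auto simp: prof Suc_diff_le)
  moreover have "sum_list lam = (\<Sum>j=1..h. ?L j)"
    unfolding sum_list_eq_sum_part[OF len(1)]
    by (rule sum.reindex_bij_witness[of _ "\<lambda>i. h + 1 - i" "\<lambda>i. h + 1 - i"]) auto
  moreover have "(\<Sum>j=1..h. (j - 1) * (?L j - ?L (j - 1) + 1)) + (\<Sum>j=1..h. ?L j) =
      h * ?L h + (h choose 2)"
  proof (rule sum_level_add_sum)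
    show "?L 0 = 0" using len by (simp add: part_beyond)
    show "?L j \<le> ?L (Suc j)" if "j < h" for j
      using that len by (intro part_mono) auto
  qed
  moreover have "?L h = part lam 1" "h + part lam 1 = n"
    using len(2) by (simp_all add: h_def)
  ultimately show ?thesis
    using choose_two_add[of h "part lam 1"] by simp
qed

lemma card_dyck_profile:
  assumes "lam \<in> hook_partitions n"
  shows "card {p. dyck_prefix p 0 (profile n lam)} = binom_weight lam"
proof -
  define h where "h = n - part lam 1"
  let ?f = "profile n lam"
  let ?b = "\<lambda>i. (part lam i - part lam (i + 2) + 1) choose (part lam (i + 1) - part lam (i + 2))"
  have len: "length lam \<le> h" "is_partition lam"
    using assms by (auto simp: h_def)
  have "h \<le> n" by (simp add: h_def)
  note prof = profile_def[of n lam, folded h_def, unfolded Let_def]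
  have "card {p. dyck_prefix p 0 ?f} = (\<Prod>j\<le>n. level_factor 0 ?f j)"
    using \<open>h \<le> n\<close> by (intro conjunct2[OF card_dyck_prefixes]) (auto simp: prof)
  \<comment> \<open>Height 0 contributes 1 because the profile vanishes there, heights from
    \<open>h\<close> on because it vanishes one level higher.\<close>
  also have "\<dots> = (\<Prod>j=1..<h. level_factor 0 ?f j)"
    using \<open>h \<le> n\<close> by (intro prod.mono_neutral_right) (auto simp: level_factor_def prof)
  also have "\<dots> = (\<Prod>i=1..<h. ?b i)"
  proof (rule prod.reindex_bij_witness[of _ "\<lambda>i. h - i" "\<lambda>i. h - i"])
    fix j assume j: "j \<in> {1..<h}"
    define i where "i = h - j"
    have i: "1 \<le> i" "h - j = i" "Suc h - j = Suc i" "Suc (Suc h) - j = Suc (Suc i)" "j = h - i"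
      using j by (auto simp: i_def)
    have mono: "part lam (Suc i) \<le> part lam i" "part lam (Suc (Suc i)) \<le> part lam (Suc i)"
      using len i by (auto intro: part_mono)
    have fj: "?f j = part lam (Suc i) - part lam (Suc (Suc i)) + 1"
      "?f (Suc j) = part lam i - part lam (Suc i) + 1"
      using j i by (auto simp: prof)
    have "level_factor 0 ?f j = ?f j + ?f (Suc j) - 1 choose ?f (Suc j)"
      using j by (simp add: level_factor_def)
    \<comment> \<open>Symmetry replaces \<open>?f (Suc j)\<close> by \<open>?f j - 1\<close>, the
      difference of the parts \<open>i + 1\<close> and \<open>i + 2\<close>; above, one of two
      summands 1 cancels.\<close>
    also have "\<dots> = ?f j + ?f (Suc j) - 1 choose (?f j - 1)"
      using fj by (subst binomial_symmetric) auto
    also have "\<dots> = ?b i"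
      using mono by (simp add: fj)
    finally show "?b (h - j) = level_factor 0 ?f j"
      using i(2) by simp
  qed auto
  also have "\<dots> = (\<Prod>i=1..h. ?b i)"
    using len by (intro prod.mono_neutral_left) (auto simp: part_def)
  also have "\<dots> = binom_weight lam"
    unfolding binom_weight_eq_finite_prod
    using len by (intro prod.mono_neutral_right) (auto simp: part_def)
  finally show ?thesis .
qed

text \<open>The partition is found by inverting \<open>part_from_profile\<close>: its parts are the
  partial sums of \<open>f j - 1\<close>.\<close>

lemma dyck_profile_in_image:
  assumes f: "dyck_prefix p 0 f" and n: "count_list p North = n"
  shows "f \<in> profile n ` hook_partitions n"
proof -
  have supp: "f 0 = 0" "\<And>j. j > n \<Longrightarrow> f j = 0"
    using dyck_prefix_support[OF f] n by auto
  have total: "(\<Sum>j\<le>n. f j) = n"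
    using dyck_prefix_sum[OF f] dyck_prefix_counts[OF f] n by simp
  \<comment> \<open>This is the greatest height of the path: \<open>dyck_prefix_gap\<close> excludes
    positive values past the first zero.\<close>
  define h where "h = (LEAST h. f (Suc h) = 0)"
  have h: "f (Suc h) = 0" "h \<le> n"
    unfolding h_def using supp(2)[of "Suc n"] by (auto intro: LeastI[of _ n] Least_le)
  have pos: "f j > 0" if "1 \<le> j" "j \<le> h" for j
    using that not_less_Least[of "j - 1" "\<lambda>h. f (Suc h) = 0"] by (auto simp: h_def)
  have zero: "f j = 0" if "j > h" for j
  proof -
    have "f (Suc (h + i)) = 0" for i
      by (induction i) (use h dyck_prefix_gap[OF f] in auto)
    then show ?thesis using that less_iff_Suc_add by auto
  qed
  define s where "s t = (\<Sum>j=1..t. f j - 1)" for t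
  have s_mono: "s t \<le> s u" if "t \<le> u" for t u
    using that unfolding s_def by (intro sum_mono2) auto
  have s0: "s 0 = 0" by (simp add: s_def)
  obtain lam where lam: "is_partition lam" "length lam \<le> h"
    "\<And>i. i \<ge> 1 \<Longrightarrow> part lam i = s (h + 1 - i)"
    by (rule ex_partition_of_parts[of "\<lambda>i. s (h + 1 - i)" h]) (auto intro: s_mono simp: s0)
  \<comment> \<open>The aim \<open>s h + h = n\<close> says that the largest part \<open>s h\<close>
    is \<open>n - h\<close>, so \<open>profile\<close> uses the same \<open>h\<close>.\<close>
  have "s h + h = (\<Sum>j=1..h. f j - 1 + 1)"
    by (simp add: s_def sum.distrib del: add_Suc_right)
  also have "\<dots> = (\<Sum>j=1..h. f j)"
    using pos by (intro sum.cong) (auto simp: Suc_le_eq)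
  also have "\<dots> = (\<Sum>j\<le>n. f j)"
    using h zero supp by (intro sum.mono_neutral_left) (auto simp: not_le Suc_le_eq)
  finally have sh: "s h + h = n" using total by simp
  then have hook: "lam \<in> hook_partitions n" and hn: "n - part lam 1 = h"
    using lam by auto
  have "f j = profile n lam j" for j
  proof (cases "1 \<le> j \<and> j \<le> h")
    case True
    then have "s j = s (j - 1) + (f j - 1)"
      by (cases j) (auto simp: s_def)
    moreover have "part lam (h + 1 - j) = s j" "part lam (h + 2 - j) = s (j - 1)"
      using True lam(3)[of "h + 1 - j"] lam(3)[of "h + 2 - j"] by auto
    ultimately show ?thesis
      unfolding profile_def hn Let_def using True pos[of j] by simp
  next
    case False
    then show ?thesis
      unfolding profile_def hn Let_def using zero supp(1) by (cases "j = 0") auto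
  qed
  with hook show ?thesis by blast
qed

section \<open>The Carlitz q-Catalan numbers\<close>

text \<open>Dyck paths are grouped by profile; \<open>coarea\<close> is constant on each group,
  whose size is \<open>binom_weight lam\<close>.\<close>

lemma carlitz_catalan_eq_sum_partitions:
  "carlitz_catalan n u = (\<Sum>lam\<in>hook_partitions n.
     of_nat (binom_weight lam) * u ^ (\<Sum>j\<le>n. (j - 1) * profile n lam j))"
proof -
  let ?F = "\<lambda>p. THE f. dyck_prefix p 0 f"
  let ?T = "profile n ` hook_partitions n"
  let ?e = "\<lambda>f. \<Sum>j\<le>n. (j - 1) * f j"
  have F: "?F p = f" if "dyck_prefix p 0 f" for p f
    using that dyck_prefix_functional by blast
  have fin: "finite ?T"
    using finite_partitions_hook by simp
  have "?F ` dyck_paths n \<subseteq> ?T"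
    using F dyck_profile_in_image by (auto simp: dyck_paths_iff)
  then have "carlitz_catalan n u = (\<Sum>f\<in>?T. \<Sum>p\<in>{p \<in> dyck_paths n. ?F p = f}. u ^ coarea p)"
    unfolding carlitz_catalan_def by (rule sum.group[OF finite_dyck_paths fin, symmetric])
  also have "\<dots> = (\<Sum>f\<in>?T. of_nat (card {p. dyck_prefix p 0 f}) * u ^ ?e f)"
  proof (rule sum.cong[OF refl])
    fix f assume "f \<in> ?T"
    then obtain lam where lam: "lam \<in> hook_partitions n" "f = profile n lam" by blast
    have total: "(\<Sum>j\<le>n. f j) = n"
    proof -
      let ?h = "n - part lam 1"
      have "(\<Sum>j\<le>n. f j) = (\<Sum>j=1..?h. f j - 1 + 1)"
        unfolding lam(2) by (rule sum.mono_neutral_cong_right) (auto simp: profile_def Let_def)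
      also have "\<dots> = part lam 1 + ?h"
        using part_from_profile[OF lam(1), of ?h] by (simp add: sum.distrib lam(2) del: add_Suc_right)
      finally show ?thesis using lam(1) by simp
    qed
    \<comment> \<open>A path back at height 0 has as many north as east steps, and the number of the
      latter is the sum of \<open>f\<close>, that is, \<open>n\<close>.\<close>
    have north: "count_list p North = n" if "dyck_prefix p 0 f" for p
    proof -
      let ?N = "max n (count_list p North)"
      have "(\<Sum>j\<le>?N. f j) = (\<Sum>j\<le>n. f j)"
        unfolding lam(2) by (rule sum.mono_neutral_right) (auto simp: profile_def Let_def)
      with total show ?thesis
        using dyck_prefix_sum[OF that, of ?N] dyck_prefix_counts[OF that] by simp
    qed
    then have "{p \<in> dyck_paths n. ?F p = f} = {p. dyck_prefix p 0 f}"
      using F by (auto simp: dyck_paths_iff)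
    moreover have "coarea p = ?e f" if "dyck_prefix p 0 f" for p
      using coarea_dyck_prefix[OF that] north[OF that] by simp
    ultimately show "(\<Sum>p\<in>{p \<in> dyck_paths n. ?F p = f}. u ^ coarea p) =
        of_nat (card {p. dyck_prefix p 0 f}) * u ^ ?e f"
      by simp
  qed
  also have "\<dots> = (\<Sum>lam\<in>hook_partitions n. of_nat (binom_weight lam) * u ^ ?e (profile n lam))"
    using inj_on_profile by (simp add: sum.reindex card_dyck_profile)
  finally show ?thesis .
qed

theorem theorem1p2:
  fixes n :: nat and q :: "'a::field"
  assumes "n \<ge> 1" and "q \<noteq> 0"
  shows "q ^ (n choose 2) * carlitz_catalan n (1 / q) =
    (\<Sum>lam | is_partition lam \<and> part lam 1 + length lam \<le> n.
       of_nat (binom_weight lam) * q ^ ((part lam 1 choose 2) + sum_list lam))"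
proof -
  \<comment> \<open>By \<open>profile_exponent\<close>, \<open>n choose 2\<close> is the coarea,
    which cancels against the power of \<open>1 / q\<close>, plus the exponent on the right.\<close>
  have "q ^ (n choose 2) * (of_nat (binom_weight lam) * (1 / q) ^ (\<Sum>j\<le>n. (j - 1) * profile n lam j))
      = of_nat (binom_weight lam) * q ^ ((part lam 1 choose 2) + sum_list lam)"
    if "lam \<in> hook_partitions n" for lam
    using assms(2) unfolding profile_exponent[OF that, symmetric] power_add power_one_over
    by simp
  then show ?thesis
    unfolding carlitz_catalan_eq_sum_partitions sum_distrib_left by (intro sum.cong) auto
qed

end
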